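(* Every delegation game with a deterministic type profile has a pure-strategy Nash equilibrium. That is, let $N=\{1,\dots,n\}$ be a finite set of agents with network $R\subseteq N^2$, deterministic types $\tau_1,\dots,\tau_n\in\{0,1\}$, accuracies $q_i\in[0.5,1]$ and efforts $e_i\ge 0$ with $q_i-e_i\ge 0.5$ for all $i\in N$. Then there is a profile $\mathbf d\in\prod_{i\in N}\Sigma_i$ such that $u_i(\mathbf d)\ge u_i((\mathbf d_{-i},j))$ for every $i\in N$ and every $j\in\Sigma_i$.
   Context: Agents and network: $N=\{1,\dots,n\}$ is a finite set of agents, $R\subseteq N^2$ is a directed graph, and $R(i)=\{j:(i,j)\in R\}$ is the neighborhood of $i$. The strategy set of agent $i$ is $\Sigma_i=\{i\}\cup R(i)$: choosing $i$ means voting directly, choosing $j\neq i$ means delegating to the neighbor $j$. Delegation profiles: a delegation profile is a vector $\mathbf d=\langle d_1,\dots,d_n\rangle\in N^n$, also seen as the map $\mathbf d:N\to N$, $i\mapsto d_i$. If iterating $\mathbf d$ from $i$ reaches a fixed point, this fixed point is denoted $d_i^*$ and called $i$'s guru. $N^*\subseteq N$ is the set of agents for which $d_i^*$ exists (i.e. whose delegation path does not end in a cycle of length at least 2). $(\mathbf d_{-i},j)$ denotes $\mathbf d$ with its $i$-th entry replaced by $j$. Accuracy and effort: each agent $i$ has an accuracy $q_i\in[0.5,1]$ (the probability that she votes according to her type if she votes directly) and an effort $e_i\ge 0$, with $q_i-e_i\ge 0.5$. Types: in a deterministic type profile, each agent $i$ has a fixed type $\tau_i\in\{0,1\}$, and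 the proximity is $p_{i,j}=1$ if $\tau_i=\tau_j$ and $p_{i,j}=0$ otherwise. Individual accuracy under $\mathbf d$: $q_i^*(\mathbf d)=q_{d_i^*}\,p_{i,d_i^*}+(1-q_{d_i^*})(1-p_{i,d_i^*})$ if $i\in N^*$, and $q_i^*(\mathbf d)=0.5$ if $i\notin N^*$. (In particular $q_i^*(\mathbf d)=q_i$ if $d_i=i$.) Utility: $u_i(\mathbf d)=q_i^*(\mathbf d)$ if $d_i\ne i$, and $u_i(\mathbf d)=q_i-e_i$ if $d_i=i$. The delegation game is the strategic game with players $N$, strategy sets $\Sigma_i$ and utilities $u_i$. *)

theory Defs
  imports Complex_Main "HOL-Library.FuncSet"
begin

definition strategies :: "(nat \<times> nat) set \<Rightarrow> nat \<Rightarrow> nat set" where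
  "strategies R i = insert i (R `` {i})"

text \<open>
  A delegation profile is a function \<open>d\<close> on agents, of which only the values on \<open>{1..n}\<close> matter.
  Since \<open>d\<close> maps \<open>{1..n}\<close> into itself, its iterates started from an agent are again agents.
\<close>

definition has_guru :: "(nat \<Rightarrow> nat) \<Rightarrow> nat \<Rightarrow> bool" where
  "has_guru d i \<longleftrightarrow> (\<exists>k. d ((d ^^ k) i) = (d ^^ k) i)"

text \<open>Meaningful only under \<^term>\<open>has_guru d i\<close>; the fixed point reached is then unique.\<close>

definition guru :: "(nat \<Rightarrow> nat) \<Rightarrow> nat \<Rightarrow> nat" where
  "guru d i = (THE g. d g = g \<and> (\<exists>k. (d ^^ k) i = g))"

definition det_proximity :: "(nat \<Rightarrow> nat) \<Rightarrow> nat \<Rightarrow> nat \<Rightarrow> real" where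
  "det_proximity \<tau> i j = (if \<tau> i = \<tau> j then 1 else 0)"

definition indiv_accuracy ::
    "(nat \<Rightarrow> real) \<Rightarrow> (nat \<Rightarrow> nat \<Rightarrow> real) \<Rightarrow> (nat \<Rightarrow> nat) \<Rightarrow> nat \<Rightarrow> real" where
  "indiv_accuracy q p d i =
     (if has_guru d i
      then q (guru d i) * p i (guru d i) + (1 - q (guru d i)) * (1 - p i (guru d i))
      else 1 / 2)"

definition utility ::
    "(nat \<Rightarrow> real) \<Rightarrow> (nat \<Rightarrow> real) \<Rightarrow> (nat \<Rightarrow> nat \<Rightarrow> real) \<Rightarrow> nat \<Rightarrow> (nat \<Rightarrow> nat) \<Rightarrow> real" where
  "utility q e p i d = (if d i = i then q i - e i else indiv_accuracy q p d i)"

text \<open>Players \<open>N\<close>, strategy sets \<open>S i\<close>, utilities \<open>u i\<close>.\<close>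

definition pure_nash_equilibrium ::
    "'i set \<Rightarrow> ('i \<Rightarrow> 's set) \<Rightarrow> ('i \<Rightarrow> ('i \<Rightarrow> 's) \<Rightarrow> real) \<Rightarrow> ('i \<Rightarrow> 's) \<Rightarrow> bool" where
  "pure_nash_equilibrium N S u d \<longleftrightarrow>
     d \<in> (\<Pi>\<^sub>E i\<in>N. S i) \<and> (\<forall>i\<in>N. \<forall>j\<in>S i. u i d \<ge> u i (d(i := j)))"

end

theory Submission
  imports Defs
begin

text \<open>
  Since \<open>q i - e i \<ge> 1/2\<close>, nobody gains from a guru of the other type or from closing a cycle, so
  only the same-type edges \<open>E\<close> matter. An equilibrium is encoded by its guru map \<open>G\<close>, which is
  built along the strongly connected components of \<open>E\<close>, sinks first, and is constant on each
  component \<open>C\<close>. Let \<open>v\<close> be the best accuracy that \<open>C\<close> can obtain through its outgoing edges. If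
  some agent of \<open>C\<close> has \<open>q i - e i \<ge> v\<close>, then the most accurate such agent becomes the guru of \<open>C\<close>:
  her deviations inside \<open>C\<close> create cycles, and those outside yield at most \<open>v\<close>. Otherwise all of
  \<open>C\<close> delegates to an outside guru of accuracy \<open>v\<close>. Shortest paths turn \<open>G\<close> into a profile.
\<close>

section \<open>Stable guru maps\<close>

text \<open>In the game, \<open>w i\<close> is the net utility \<open>q i - e i\<close> of voting directly.\<close>

definition stable_at ::
    "('a \<times> 'a) set \<Rightarrow> ('a \<Rightarrow> real) \<Rightarrow> ('a \<Rightarrow> real) \<Rightarrow> ('a \<Rightarrow> 'a) \<Rightarrow> 'a \<Rightarrow> bool" where
  "stable_at E q w G i \<longleftrightarrow>
     (i, G i) \<in> {(x, y) \<in> E. G x = G y}\<^sup>* \<and>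
     (if G i = i then \<forall>j\<in>E `` {i}. G j = i \<or> q (G j) \<le> w i
      else w i \<le> q (G i) \<and> (\<forall>j\<in>E `` {i}. q (G j) \<le> q (G i)))"

lemma rtrancl_Image_closed:
  assumes "E `` A \<subseteq> A" and "(x, y) \<in> E\<^sup>*" and "x \<in> A"
  shows "y \<in> A"
  using assms(2,3,1) by (induction rule: rtrancl_induct) auto

lemma rtrancl_cong_closed:
  assumes "E `` A \<subseteq> A" and "\<And>x. x \<in> A \<Longrightarrow> G' x = G x"
    and "(x, y) \<in> {(x, y) \<in> E. G x = G y}\<^sup>*" and "x \<in> A"
  shows "(x, y) \<in> {(x, y) \<in> E. G' x = G' y}\<^sup>*"
proof -
  have "y \<in> A \<and> (x, y) \<in> {(x, y) \<in> E. G' x = G' y}\<^sup>*"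
    using assms(3)
  proof (induction rule: rtrancl_induct)
    case base
    then show ?case using assms(4) by simp
  next
    case (step y z)
    have "z \<in> A" using step assms(1) by blast
    moreover have "(y, z) \<in> {(x, y) \<in> E. G' x = G' y}"
      using step assms(2) \<open>z \<in> A\<close> by auto
    ultimately show ?case using step.IH by (meson rtrancl.rtrancl_into_rtrancl)
  qed
  then show ?thesis by blast
qed

text \<open>Stability at \<open>i\<close> depends on \<open>G\<close> only along paths from
  \<open>i\<close>, and these stay in \<open>A\<close>. So values outside a closed set can be fixed
  later without disturbing it.\<close>

lemma stable_at_cong:
  assumes "E `` A \<subseteq> A" and "\<And>x. x \<in> A \<Longrightarrow> G' x = G x" and "i \<in> A"
    and "stable_at E q w G i"
  shows "stable_at E q w G' i"
proof -
  have "G' j = G j" if "j \<in> E `` {i}" for j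
    using that assms(1-3) by blast
  moreover have "(i, G' i) \<in> {(x, y) \<in> E. G' x = G' y}\<^sup>*"
    using rtrancl_cong_closed[of E A G' G] assms unfolding stable_at_def by simp
  ultimately show ?thesis
    using assms unfolding stable_at_def by simp
qed

lemma finite_obtains_max:
  fixes f :: "'a \<Rightarrow> 'b::linorder"
  assumes "finite S" and "S \<noteq> {}"
  obtains x where "x \<in> S" and "\<And>y. y \<in> S \<Longrightarrow> f y \<le> f x"
proof -
  have "Max (f ` S) \<in> f ` S" using assms by (intro Max_in) auto
  then obtain x where "x \<in> S" "f x = Max (f ` S)" by auto
  then show thesis using that assms(1) by simp
qed

text \<open>Absorbs one component: \<open>G\<close> is kept on \<open>A\<close> and overwritten by a
  constant \<open>g\<close> on \<open>C\<close>. The work lies in choosing \<open>g\<close>, either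
  in \<open>C\<close> or in \<open>A\<close>.\<close>

lemma stable_extend_component:
  assumes fin: "finite A" "finite C" and "C \<noteq> {}" and disj: "A \<inter> C = {}"
    and clA: "E `` A \<subseteq> A" and clC: "E `` C \<subseteq> A \<union> C"
    and conn: "\<And>x y. x \<in> C \<Longrightarrow> y \<in> C \<Longrightarrow> (x, y) \<in> (E \<inter> C \<times> C)\<^sup>*"
    and wq: "\<And>i. i \<in> C \<Longrightarrow> w i \<le> q i"
    and stab: "\<And>i. i \<in> A \<Longrightarrow> stable_at E q w G i"
  shows "\<exists>G'. \<forall>i\<in>A \<union> C. stable_at E q w G' i"
proof -
  \<comment> \<open>\<open>X\<close> holds the outside neighbors of \<open>C\<close>, and
    \<open>Q\<close> the members whose direct vote is at least as good as every guru offered by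
    \<open>X\<close>. If \<open>X\<close> is empty, \<open>Q\<close> is all of
    \<open>C\<close>.\<close>
  define X where "X = (E `` C) \<inter> A"
  define Q where "Q = {i \<in> C. \<forall>a\<in>X. q (G a) \<le> w i}"
  have finX: "finite X" and finQ: "finite Q" using fin by (auto simp: X_def Q_def)
  define G' where "G' g x = (if x \<in> C then g else G x)" for g x
  have G'A: "G' g x = G x" if "x \<in> A" for g x using that disj by (auto simp: G'_def)
  have G'C: "G' g x = g" if "x \<in> C" for g x using that by (auto simp: G'_def)
  have stabA: "stable_at E q w (G' g) i" if "i \<in> A" for g i
    using stable_at_cong[OF clA, of "G' g" G] G'A that stab by blast
  have path: "(x, y) \<in> {(x, y) \<in> E. G' g x = G' g y}\<^sup>*" if "x \<in> C" "y \<in> C" for x y g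
    using conn[OF that] by (rule rtrancl_mono[THEN subsetD, rotated]) (auto simp: G'C)
  have step: "j \<in> C \<and> G' g j = g \<or> j \<in> X \<and> G' g j = G j" if "i \<in> C" "j \<in> E `` {i}" for i j g
    using that clC G'A G'C unfolding X_def by blast
  show ?thesis
  proof (cases "Q = {}")
    case False
    then obtain g where gQ: "g \<in> Q" and gmax: "\<And>h. h \<in> Q \<Longrightarrow> q h \<le> q g"
      using finite_obtains_max[OF finQ] by blast
    have gC: "g \<in> C" and gX: "\<And>a. a \<in> X \<Longrightarrow> q (G a) \<le> w g"
      using gQ by (auto simp: Q_def)
    have wg: "w g \<le> q g" using wq gC .
    \<comment> \<open>For a member outside \<open>Q\<close>, some outside guru beats her direct
      vote, yet that guru is no more accurate than \<open>w g\<close>.\<close>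
    have wC: "w i \<le> q g" if i: "i \<in> C" for i
    proof (cases "i \<in> Q")
      case True
      then show ?thesis using gmax[of i] wq[OF i] by simp
    next
      case False
      then obtain a where "a \<in> X" "w i < q (G a)" using i by (auto simp: Q_def not_le)
      then show ?thesis using gX[of a] wg by simp
    qed
    have "stable_at E q w (G' g) i" if "i \<in> C" for i
    proof -
      \<comment> \<open>The first bound serves members other than \<open>g\<close>. The second
        serves \<open>g\<close>: neighbors that she leads are exempt, since delegating to them would
        close a cycle.\<close>
      have "q (G' g j) \<le> q g" if "j \<in> E `` {i}" for j
        using step[OF \<open>i \<in> C\<close> that, of g] gX[of j] wg by auto
      moreover have "G' g j = g \<or> q (G' g j) \<le> w g" if "j \<in> E `` {i}" for j
        using step[OF \<open>i \<in> C\<close> that, of g] gX[of j] by auto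
      ultimately show ?thesis
        using path[OF that gC, of g] wC[OF that] unfolding stable_at_def G'C[OF that] by auto
    qed
    then show ?thesis using stabA by blast
  next
    case True
    then have "X \<noteq> {}" using \<open>C \<noteq> {}\<close> by (auto simp: Q_def)
    then obtain a where aX: "a \<in> X" and amax: "\<And>b. b \<in> X \<Longrightarrow> q (G b) \<le> q (G a)"
      using finite_obtains_max[OF finX, of "\<lambda>a. q (G a)"] by blast
    obtain c where c: "c \<in> C" "(c, a) \<in> E" and aA: "a \<in> A" using aX by (auto simp: X_def)
    define g where "g = G a"
    have pa: "(a, g) \<in> {(x, y) \<in> E. G' g x = G' g y}\<^sup>*"
      using stabA[OF aA, of g] G'A[OF aA, of g] unfolding stable_at_def g_def by simp
    have "(a, g) \<in> E\<^sup>*"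
      using pa by (rule rtrancl_mono[THEN subsetD, rotated]) auto
    then have gA: "g \<in> A" using rtrancl_Image_closed[OF clA] aA by blast
    have ca: "(c, a) \<in> {(x, y) \<in> E. G' g x = G' g y}"
      using c G'A[OF aA, of g] G'C[OF c(1), of g] by (simp add: g_def)
    have wC: "w i \<le> q g" if i: "i \<in> C" for i
    proof -
      obtain b where "b \<in> X" "w i < q (G b)" using i True by (auto simp: Q_def not_le)
      then show ?thesis using amax[of b] by (simp add: g_def)
    qed
    have "stable_at E q w (G' g) i" if "i \<in> C" for i
    proof -
      have "q (G' g j) \<le> q g" if "j \<in> E `` {i}" for j
        using step[OF \<open>i \<in> C\<close> that, of g] amax[of j] by (auto simp: g_def)
      \<comment> \<open>The path runs inside \<open>C\<close> to the exit \<open>c\<close>, crosses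
        to \<open>a\<close>, and then follows the path of \<open>a\<close> to its guru.\<close>
      moreover have "(i, g) \<in> {(x, y) \<in> E. G' g x = G' g y}\<^sup>*"
        using path[OF that c(1), of g] ca pa by (meson rtrancl.rtrancl_into_rtrancl rtrancl_trans)
      moreover have "g \<noteq> i" using gA that disj by blast
      ultimately show ?thesis
        using wC[OF that] unfolding stable_at_def G'C[OF that] by auto
    qed
    then show ?thesis using stabA by blast
  qed
qed

text \<open>\<open>A\<close> together with everything reachable from \<open>x\<close> inside
  \<open>B - A\<close> is closed and strictly larger than \<open>A\<close>, so minimality makes it
  all of \<open>B\<close>.\<close>

lemma minimal_closed_extension_connected:
  assumes clA: "E `` A \<subseteq> A" and clB: "E `` B \<subseteq> B" and "A \<subset> B"
    and minB: "\<And>B'. A \<subset> B' \<Longrightarrow> B' \<subseteq> B \<Longrightarrow> E `` B' \<subseteq> B' \<Longrightarrow> B' = B"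
    and xy: "x \<in> B - A" "y \<in> B - A"
  shows "(x, y) \<in> (E \<inter> (B - A) \<times> (B - A))\<^sup>*"
proof -
  define F where "F = E \<inter> (B - A) \<times> (B - A)"
  define B' where "B' = A \<union> {z \<in> B - A. (x, z) \<in> F\<^sup>*}"
  have "z' \<in> B'" if "z \<in> B'" "(z, z') \<in> E" for z z'
  proof (cases "z' \<in> A")
    case True
    then show ?thesis by (simp add: B'_def)
  next
    case False
    then have "z \<notin> A" using that clA by blast
    then have z: "z \<in> B - A" "(x, z) \<in> F\<^sup>*" using that by (auto simp: B'_def)
    then have "z' \<in> B - A" using clB that False by blast
    then have "(z, z') \<in> F" using z that by (simp add: F_def)
    then have "(x, z') \<in> F\<^sup>*" using z by (meson rtrancl.rtrancl_into_rtrancl)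
    then show ?thesis using \<open>z' \<in> B - A\<close> by (simp add: B'_def)
  qed
  then have "E `` B' \<subseteq> B'" by blast
  moreover have "A \<subset> B'" "B' \<subseteq> B" using xy \<open>A \<subset> B\<close> by (auto simp: B'_def)
  ultimately have "B' = B" using minB by blast
  then show ?thesis using xy unfolding B'_def F_def by blast
qed

text \<open>A maximality argument replaces a topological ordering of the components: a largest
  closed set carrying a stable map could be enlarged by one component unless it is
  \<open>N\<close>.\<close>

lemma stable_guru_map_exists:
  assumes fin: "finite N" and EN: "E \<subseteq> N \<times> N" and wq: "\<And>i. i \<in> N \<Longrightarrow> w i \<le> q i"
  shows "\<exists>G. \<forall>i\<in>N. stable_at E q w G i"
proof -
  define \<A> where
    "\<A> = {A. A \<subseteq> N \<and> E `` A \<subseteq> A \<and> (\<exists>G. \<forall>i\<in>A. stable_at E q w G i)}"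
  have "finite \<A>" using fin by (auto simp: \<A>_def)
  moreover have "{} \<in> \<A>" by (simp add: \<A>_def)
  ultimately obtain A where A: "A \<in> \<A>" and maxA: "\<And>B. B \<in> \<A> \<Longrightarrow> A \<subseteq> B \<Longrightarrow> A = B"
    using finite_has_maximal[of \<A>] by blast
  then obtain G where AN: "A \<subseteq> N" and clA: "E `` A \<subseteq> A"
    and G: "\<And>i. i \<in> A \<Longrightarrow> stable_at E q w G i"
    unfolding \<A>_def by blast
  have "A = N"
  proof (rule ccontr)
    assume "A \<noteq> N"
    \<comment> \<open>For a minimal closed \<open>B\<close> strictly above \<open>A\<close>, the
      difference \<open>B - A\<close> is strongly connected.\<close>
    define \<B> where "\<B> = {B. A \<subset> B \<and> B \<subseteq> N \<and> E `` B \<subseteq> B}"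
    have "finite \<B>" using fin by (auto simp: \<B>_def)
    moreover have "N \<in> \<B>" using AN \<open>A \<noteq> N\<close> EN by (auto simp: \<B>_def)
    ultimately obtain B where B: "B \<in> \<B>" and minB: "\<And>B'. B' \<in> \<B> \<Longrightarrow> B' \<subseteq> B \<Longrightarrow> B = B'"
      using finite_has_minimal[of \<B>] by blast
    have AB: "A \<subset> B" and BN: "B \<subseteq> N" and clB: "E `` B \<subseteq> B" using B by (auto simp: \<B>_def)
    have min: "B' = B" if "A \<subset> B'" "B' \<subseteq> B" "E `` B' \<subseteq> B'" for B'
      using minB[of B'] that BN by (auto simp: \<B>_def)
    have "\<exists>G'. \<forall>i\<in>A \<union> (B - A). stable_at E q w G' i"
    proof (rule stable_extend_component[where G = G])
      show "finite A" "finite (B - A)" using fin AN BN by (meson finite_subset finite_Diff)+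
      show "(x, y) \<in> (E \<inter> (B - A) \<times> (B - A))\<^sup>*" if "x \<in> B - A" "y \<in> B - A" for x y
        using minimal_closed_extension_connected[OF clA clB AB min that] .
    qed (use AB BN clA clB wq G in auto)
    then have "B \<in> \<A>" using AB BN clB by (auto simp: \<A>_def Un_absorb1)
    then show False using maxA AB by blast
  qed
  then show ?thesis using G by blast
qed

section \<open>Delegation paths\<close>

lemma funpow_fixpoint: "d x = x \<Longrightarrow> (d ^^ k) x = x"
  by (induction k) auto

lemma guru_eqI:
  assumes "d g = g" and "(d ^^ k) i = g"
  shows "has_guru d i" and "guru d i = g"
proof -
  show "has_guru d i" using assms by (auto simp: has_guru_def)
  have "g' = g" if "d g' = g'" "(d ^^ l) i = g'" for g' l
  proof -
    have "(d ^^ (k + l)) i = g'" using that by (simp add: funpow_add funpow_fixpoint)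
    moreover have "(d ^^ (k + l)) i = g"
      using assms by (simp add: add.commute[of k] funpow_add funpow_fixpoint)
    ultimately show ?thesis by simp
  qed
  then show "guru d i = g" unfolding guru_def using assms by (intro the_equality) blast+
qed

lemma not_has_guru_cycle:
  assumes "(d ^^ Suc k) i = i" and "d i \<noteq> i"
  shows "\<not> has_guru d i"
proof
  assume "has_guru d i"
  then obtain l where l: "d ((d ^^ l) i) = (d ^^ l) i" by (auto simp: has_guru_def)
  have "((d ^^ Suc k) ^^ l) i = i" using assms(1) by (rule funpow_fixpoint)
  \<comment> \<open>After \<open>l\<close> rounds of the cycle the path is back at \<open>i\<close>,
    but the fixed point met at step \<open>l\<close> has been kept since then, so it must be
    \<open>i\<close>.\<close>
  then have "(d ^^ (k * l + l)) i = i"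
    by (simp only: funpow_mult mult.commute[of l] mult_Suc add.commute[of l])
  then have "(d ^^ l) i = i" using funpow_fixpoint[of d, OF l, of "k * l"] by (simp add: funpow_add)
  then show False using l assms(2) by simp
qed

text \<open>The rank \<open>r\<close> falls along every delegation, which excludes cycles and
  provides the measure for the inductions below.\<close>

definition realizes :: "'a set \<Rightarrow> ('a \<times> 'a) set \<Rightarrow> ('a \<Rightarrow> 'a) \<Rightarrow> ('a \<Rightarrow> 'a) \<Rightarrow> ('a \<Rightarrow> nat) \<Rightarrow> bool" where
  "realizes N E G d r \<longleftrightarrow>
     (\<forall>i\<in>N. if G i = i then d i = i
             else (i, d i) \<in> E \<and> d i \<in> N \<and> G (d i) = G i \<and> r (d i) < r i)"

lemma realizes_exists:
  assumes EN: "E \<subseteq> N \<times> N" and path: "\<And>i. i \<in> N \<Longrightarrow> (i, G i) \<in> {(x, y) \<in> E. G x = G y}\<^sup>*"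
  shows "\<exists>d r. d \<in> extensional N \<and> realizes N E G d r"
proof -
  define S where "S = {(x, y) \<in> E. G x = G y}"
  \<comment> \<open>The distance from \<open>i\<close> to its guru along edges that preserve the
    guru.\<close>
  define r where "r i = (LEAST n. (i, G i) \<in> S ^^ n)" for i
  have next_ex: "\<exists>y. (i, y) \<in> E \<and> y \<in> N \<and> G y = G i \<and> r y < r i" if i: "i \<in> N" "G i \<noteq> i" for i
  proof -
    have "\<exists>n. (i, G i) \<in> S ^^ n" using path[OF i(1)] by (simp add: S_def rtrancl_power)
    then have ri: "(i, G i) \<in> S ^^ r i" unfolding r_def by (rule LeastI_ex)
    then obtain m where m: "r i = Suc m" using i(2) by (cases "r i") auto
    obtain y where y: "(i, y) \<in> S" "(y, G i) \<in> S ^^ m"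
      using ri unfolding m by (meson relpow_Suc_D2)
    then have yE: "(i, y) \<in> E" "G y = G i" by (auto simp: S_def)
    have "r y \<le> m" unfolding r_def using y yE by (intro Least_le) simp
    then show ?thesis using yE EN m by (intro exI[of _ y]) auto
  qed
  define d where "d = (\<lambda>i\<in>N. if G i = i then i
    else SOME y. (i, y) \<in> E \<and> y \<in> N \<and> G y = G i \<and> r y < r i)"
  have "realizes N E G d r" unfolding realizes_def
    using someI_ex[OF next_ex] by (auto simp: d_def)
  then show ?thesis by (auto simp: d_def intro!: exI[of _ d])
qed

lemma realizes_reaches:
  assumes "realizes N E G d r" and "x \<in> N"
  shows "\<exists>k. (d ^^ k) x = G x"
  using assms(2)
proof (induction "r x" arbitrary: x rule: less_induct)
  case less
  show ?case
  proof (cases "G x = x")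
    case True
    then show ?thesis by (intro exI[of _ 0]) simp
  next
    case False
    then have "r (d x) < r x" "d x \<in> N" "G (d x) = G x"
      using less.prems assms(1) by (auto simp: realizes_def)
    then obtain k where "(d ^^ k) (d x) = G x" using less.hyps by metis
    then show ?thesis by (intro exI[of _ "Suc k"]) (simp add: funpow_swap1)
  qed
qed

text \<open>A deviation by \<open>i\<close> cannot affect a path before it meets \<open>i\<close>,
  so until then the path follows \<open>d\<close> towards its old guru.\<close>

lemma realizes_deviation_reaches:
  assumes "realizes N E G d r" and "x \<in> N"
  shows "\<exists>k. (d(i := j) ^^ k) x = G x \<and> G x \<noteq> i \<or> (d(i := j) ^^ k) x = i"
  using assms(2)
proof (induction "r x" arbitrary: x rule: less_induct)
  case less
  show ?case
  proof (cases "G x = x \<or> x = i")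
    case True
    then show ?thesis by (intro exI[of _ 0]) auto
  next
    case False
    then have "r (d x) < r x" "d x \<in> N" "G (d x) = G x"
      using less.prems assms(1) by (auto simp: realizes_def)
    then obtain k where "(d(i := j) ^^ k) (d x) = G x \<and> G x \<noteq> i \<or> (d(i := j) ^^ k) (d x) = i"
      using less.hyps by metis
    then show ?thesis using False by (intro exI[of _ "Suc k"]) (simp add: funpow_swap1)
  qed
qed

lemma realizes_guru:
  assumes "realizes N E G d r" and "x \<in> N" and "G x \<in> N" and "G (G x) = G x"
  shows "has_guru d x" and "guru d x = G x"
proof -
  obtain k where "(d ^^ k) x = G x" using realizes_reaches[OF assms(1,2)] by blast
  moreover have "d (G x) = G x" using assms by (auto simp: realizes_def)
  ultimately show "has_guru d x" and "guru d x = G x" using guru_eqI by metis+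
qed

text \<open>A path from \<open>j\<close> back to \<open>i\<close> would close a cycle through the
  new choice, so if \<open>i\<close> still has a guru, the path from \<open>j\<close> avoids
  \<open>i\<close> and ends where it did under \<open>d\<close>.\<close>

lemma realizes_deviation_guru:
  assumes "realizes N E G d r" and "j \<in> N" and "G j \<in> N" and "G (G j) = G j"
    and "j \<noteq> i" and "has_guru (d(i := j)) i"
  shows "guru (d(i := j)) i = G j" and "G j \<noteq> i"
proof -
  let ?d = "d(i := j)"
  obtain k where k: "(?d ^^ k) j = G j \<and> G j \<noteq> i \<or> (?d ^^ k) j = i"
    using realizes_deviation_reaches[OF assms(1,2)] by blast
  have Suc: "(?d ^^ Suc k) i = (?d ^^ k) j" by (simp add: funpow_swap1)
  have "(?d ^^ k) j \<noteq> i"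
    using not_has_guru_cycle[of k ?d i] Suc assms(5,6) by auto
  then have Gj: "(?d ^^ Suc k) i = G j" "G j \<noteq> i" using k Suc by auto
  then have "?d (G j) = G j" using assms(1,3,4) by (auto simp: realizes_def)
  then show "guru ?d i = G j" "G j \<noteq> i" using guru_eqI(2) Gj by metis+
qed

section \<open>Equilibrium of the delegation game\<close>

theorem theorem1:
  fixes n :: nat and R :: "(nat \<times> nat) set"
    and \<tau> :: "nat \<Rightarrow> nat" and q e :: "nat \<Rightarrow> real"
  assumes "R \<subseteq> {1..n} \<times> {1..n}"
    and "\<And>i. i \<in> {1..n} \<Longrightarrow> \<tau> i \<in> {0, 1}"
    and "\<And>i. i \<in> {1..n} \<Longrightarrow> q i \<in> {1/2..1}"
    and "\<And>i. i \<in> {1..n} \<Longrightarrow> e i \<ge> 0"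
    and "\<And>i. i \<in> {1..n} \<Longrightarrow> q i - e i \<ge> 1/2"
  shows "\<exists>d. pure_nash_equilibrium {1..n} (strategies R) (utility q e (det_proximity \<tau>)) d"
proof -
  define N where "N = {1..n}"
  note assms = assms[folded N_def]
  define E where "E = {(i, j) \<in> R. \<tau> i = \<tau> j}"
  define w where "w i = q i - e i" for i
  have EN: "E \<subseteq> N \<times> N" using assms(1) by (auto simp: E_def)
  obtain G where stab: "\<And>i. i \<in> N \<Longrightarrow> stable_at E q w G i"
  proof -
    have "finite N" "\<And>i. i \<in> N \<Longrightarrow> w i \<le> q i" using assms(4)
      by (simp_all add: N_def w_def)
    then show thesis using stable_guru_map_exists[OF _ EN, of w q] that by blast
  qed
  then have path: "(i, G i) \<in> {(x, y) \<in> E. G x = G y}\<^sup>*" if "i \<in> N" for i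
    using that by (simp add: stable_at_def)
  have inv: "y \<in> N \<and> G y = G x \<and> \<tau> y = \<tau> x"
    if "(x, y) \<in> {(x, y) \<in> E. G x = G y}\<^sup>*" "x \<in> N" for x y
    using that by (induction rule: rtrancl_induct) (use EN in \<open>auto simp: E_def\<close>)
  have GN: "G i \<in> N" "G (G i) = G i" "\<tau> (G i) = \<tau> i" if "i \<in> N" for i
    using inv[OF path] that by auto
  obtain d r where ext: "d \<in> extensional N" and real: "realizes N E G d r"
    using realizes_exists[OF EN path] by blast
  let ?u = "utility q e (det_proximity \<tau>)"
  have "d i \<in> strategies R i" if "i \<in> N" for i
    using real that by (cases "G i = i") (auto simp: realizes_def strategies_def E_def)
  then have "d \<in> (\<Pi>\<^sub>E i\<in>N. strategies R i)" using ext by (auto simp: PiE_iff)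
  moreover have "?u i d \<ge> ?u i (d(i := j))" if i: "i \<in> N" and j: "j \<in> strategies R i" for i j
  proof -
    have fixed: "d i = i \<longleftrightarrow> G i = i" using real i by (auto simp: realizes_def split: if_splits)
    have u: "?u i d = (if G i = i then w i else q (G i))"
      using realizes_guru[OF real i GN(1,2)[OF i]] fixed GN(3)[OF i]
      by (simp add: utility_def indiv_accuracy_def det_proximity_def w_def)
    \<comment> \<open>This bound defeats both deviations into a cycle, worth exactly 1/2, and those
      to a guru of the other type, worth at most 1/2.\<close>
    have half: "?u i d \<ge> 1/2" using assms(3)[OF GN(1)[OF i]] assms(5)[OF i] u by (simp add: w_def)
    have self: "?u i d \<ge> w i" using stab[OF i] u by (auto simp: stable_at_def)
    show ?thesis
    proof (cases "j = i")
      case True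
      then show ?thesis using self by (simp add: utility_def w_def)
    next
      case False
      then have jR: "(i, j) \<in> R" "j \<in> N" using j assms(1) by (auto simp: strategies_def)
      have dev: "?u i (d(i := j)) = indiv_accuracy q (det_proximity \<tau>) (d(i := j)) i"
        using False by (simp add: utility_def)
      show ?thesis
      proof (cases "has_guru (d(i := j)) i")
        case nog: False
        then show ?thesis using half dev by (simp add: indiv_accuracy_def)
      next
        case True
        note dg = realizes_deviation_guru[OF real jR(2) GN(1,2)[OF jR(2)] False True]
        have dev': "?u i (d(i := j)) = (if \<tau> i = \<tau> j then q (G j) else 1 - q (G j))"
          using dev True dg GN(3)[OF jR(2)] by (simp add: indiv_accuracy_def det_proximity_def)
        show ?thesis
        proof (cases "\<tau> i = \<tau> j")
          case same: True
          then have "j \<in> E `` {i}" using jR by (simp add: E_def)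
          \<comment> \<open>If \<open>i\<close> votes directly, \<open>G j \<noteq> i\<close> rules
            out the exempt alternative in \<open>stable_at\<close>.\<close>
          then have "q (G j) \<le> ?u i d"
            using stab[OF i] dg(2) u by (auto simp: stable_at_def split: if_splits)
          then show ?thesis using dev' same by simp
        next
          case diff: False
          then show ?thesis using dev' half assms(3)[OF GN(1)[OF jR(2)]] by simp
        qed
      qed
    qed
  qed
  ultimately show ?thesis unfolding pure_nash_equilibrium_def N_def by blast
qed

end
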